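(* Let $0<l<L$, $a>0$, $\sigma>0$ be constants and let $\varphi,\psi$ be given functions on $[0,L]$. Consider the coupled initial-boundary value problem for $u=u(x,t)$, $x\in[0,L]$, $t\ge 0$: $$u_{tt}-a^2u_{xx}=0\quad (0<x<l \text{ or } l<x<L,\ t>0),$$ $$u(0,t)=0,\qquad u(L,t)=0,$$ $$u(l-0,t)=u(l+0,t),\qquad -u_x(l-0,t)+u_x(l+0,t)=\sigma u(l,t),$$ $$u(x,0)=\varphi(x),\qquad u_t(x,0)=\psi(x).$$ If a classical solution to this problem exists, then it is unique.
   Context: Here $u_x(l\mp 0,t)$ and $u(l\mp 0,t)$ denote the one-sided limits at $x=l$ from the left and from the right. A classical solution is a function $u$ that is continuous on $[0,L]\times[0,\infty)$, whose restrictions to $[0,l]\times[0,\infty)$ and to $[l,L]\times[0,\infty)$ are $C^2$ (one-sided derivatives at the ends), which is $C^1$ in $t$ at $x=l$, and which satisfies all the equations and conditions of the problem pointwise. *)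

theory Defs
  imports "HOL-Analysis.Analysis"
begin

text \<open>
  \<open>Ck_on k I J u\<close>: the function \<open>u\<close> of two variables is of class C^k on \<open>I \<times> J\<close>, i.e. all its
  partial derivatives of order at most \<open>k\<close> exist and are continuous on \<open>I \<times> J\<close>. The derivatives
  are taken within \<open>I\<close> and \<open>J\<close>, hence one-sided at endpoints; for nondegenerate intervals
  \<open>I\<close> and \<open>J\<close> they are uniquely determined. Values of \<open>u\<close> outside \<open>I \<times> J\<close> are irrelevant.
\<close>

fun Ck_on :: "nat \<Rightarrow> real set \<Rightarrow> real set \<Rightarrow> (real \<Rightarrow> real \<Rightarrow> real) \<Rightarrow> bool" where
  "Ck_on 0 I J u \<longleftrightarrow> continuous_on (I \<times> J) (\<lambda>(x, t). u x t)"
| "Ck_on (Suc k) I J u \<longleftrightarrow>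
     continuous_on (I \<times> J) (\<lambda>(x, t). u x t) \<and>
     (\<exists>ux ut.
        (\<forall>x\<in>I. \<forall>t\<in>J. ((\<lambda>\<xi>. u \<xi> t) has_real_derivative ux x t) (at x within I)) \<and>
        (\<forall>x\<in>I. \<forall>t\<in>J. ((\<lambda>\<tau>. u x \<tau>) has_real_derivative ut x t) (at t within J)) \<and>
        Ck_on k I J ux \<and> Ck_on k I J ut)"

definition classical_regularity ::
  "real \<Rightarrow> real \<Rightarrow> (real \<Rightarrow> real \<Rightarrow> real) \<Rightarrow> bool" where
  "classical_regularity l L u \<longleftrightarrow>
     continuous_on ({0..L} \<times> {0..}) (\<lambda>(x, t). u x t) \<and>
     Ck_on 2 {0..l} {0..} u \<and>
     Ck_on 2 {l..L} {0..} u \<and>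
     (\<exists>ut. continuous_on {0..} ut \<and>
        (\<forall>t\<ge>0. ((\<lambda>\<tau>. u l \<tau>) has_real_derivative ut t) (at t within {0..})))"

text \<open>
  The differential equation is imposed at interior points only, where two-sided derivatives of the
  regular functions considered here exist. The one-sided limits \<open>u(l \<mp> 0, t)\<close> and
  \<open>u\<^sub>x(l \<mp> 0, t)\<close> are required to exist and to satisfy the interface conditions. The derivative
  \<open>u\<^sub>t(x, 0)\<close> is the one-sided one.
\<close>

definition classical_solution ::
  "real \<Rightarrow> real \<Rightarrow> real \<Rightarrow> real \<Rightarrow> (real \<Rightarrow> real) \<Rightarrow> (real \<Rightarrow> real) \<Rightarrow>
   (real \<Rightarrow> real \<Rightarrow> real) \<Rightarrow> bool" where
  "classical_solution l L a \<sigma> \<phi> \<psi> u \<longleftrightarrow>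
     classical_regularity l L u \<and>
     (\<forall>x\<in>{0<..<l} \<union> {l<..<L}. \<forall>t>0.
        (deriv ^^ 2) (\<lambda>\<tau>. u x \<tau>) t - a\<^sup>2 * (deriv ^^ 2) (\<lambda>\<xi>. u \<xi> t) x = 0) \<and>
     (\<forall>t\<ge>0. u 0 t = 0 \<and> u L t = 0) \<and>
     (\<forall>t\<ge>0. \<exists>ul ur.
        ((\<lambda>x. u x t) \<longlongrightarrow> ul) (at_left l) \<and>
        ((\<lambda>x. u x t) \<longlongrightarrow> ur) (at_right l) \<and>
        ul = ur) \<and>
     (\<forall>t\<ge>0. \<exists>pl pr.
        (deriv (\<lambda>\<xi>. u \<xi> t) \<longlongrightarrow> pl) (at_left l) \<and>
        (deriv (\<lambda>\<xi>. u \<xi> t) \<longlongrightarrow> pr) (at_right l) \<and>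
        - pl + pr = \<sigma> * u l t) \<and>
     (\<forall>x\<in>{0..L}. u x 0 = \<phi> x) \<and>
     (\<forall>x\<in>{0..L}. ((\<lambda>\<tau>. u x \<tau>) has_real_derivative \<psi> x) (at 0 within {0..}))"

end

theory Submission imports Defs begin

text \<open>
  The proof is the energy method. The difference \<open>w\<close> of two classical solutions solves the same
  problem with zero initial data. On a piece \<open>[p, q]\<close> of the string, the energy
  \<open>\<integral> (w\<^sub>t\<^sup>2 + a\<^sup>2 w\<^sub>x\<^sup>2) dx\<close> changes at the rate \<open>2 a\<^sup>2 (w\<^sub>x w\<^sub>t)\<close> taken between the ends of the piece:
  differentiate under the integral sign, replace \<open>w\<^sub>t\<^sub>t\<close> by \<open>a\<^sup>2 w\<^sub>x\<^sub>x\<close>, and recognise an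
  \<open>x\<close>-derivative (\<open>energy_balance\<close>). When the two pieces are added, the fluxes through \<open>0\<close> and
  \<open>L\<close> vanish, because \<open>w\<close> is zero there at all times; the fluxes at \<open>l\<close> leave
  \<open>2 a\<^sup>2 (w\<^sub>x(l-0) - w\<^sub>x(l+0)) w\<^sub>t(l) = - 2 a\<^sup>2 \<sigma> w(l) w\<^sub>t(l)\<close>, which is the time derivative of
  \<open>- a\<^sup>2 \<sigma> w(l)\<^sup>2\<close>. So the total energy \<open>E\<^sub>1 + E\<^sub>2 + a\<^sup>2 \<sigma> w(l)\<^sup>2\<close>, with the elastic energy of the
  point \<open>l\<close> included, is conserved. It is zero initially and, as \<open>\<sigma> > 0\<close>, each of its terms is
  nonnegative; hence \<open>w\<^sub>t = 0\<close> everywhere and \<open>w\<close> keeps its initial value \<open>0\<close>.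

  The regularity assumption supplies the two mixed derivatives of each solution as unrelated
  functions. The energy balance needs their equality, which is proved in
  \<open>mixed_partials_commute\<close>.
\<close>

section \<open>Twice differentiable functions on a strip\<close>

lemma continuous_on_swap_args:
  assumes "continuous_on (A \<times> B) (\<lambda>(x, t). f x t)"
  shows "continuous_on (B \<times> A) (\<lambda>(t, x). f x t)"
proof -
  have "continuous_on (B \<times> A) (\<lambda>z. (\<lambda>(x, t). f x t) (snd z, fst z))"
    by (rule continuous_on_compose2[OF assms]) (auto intro!: continuous_intros)
  then show ?thesis
    by (simp add: split_beta)
qed

lemma continuous_on_fixed_snd:
  assumes "continuous_on (A \<times> B) (\<lambda>(x, t). f x t)" and "t \<in> B"
  shows "continuous_on A (\<lambda>x. f x t)"
proof -
  have "continuous_on A (\<lambda>x. (\<lambda>(x, t). f x t) (x, t))"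
    by (rule continuous_on_compose2[OF assms(1)]) (use assms(2) in \<open>auto intro!: continuous_intros\<close>)
  then show ?thesis
    by simp
qed

lemma has_real_derivative_unique_half_line:
  fixes f :: "real \<Rightarrow> real"
  assumes "(f has_real_derivative D) (at t within {0..})"
    and "(f has_real_derivative E) (at t within {0..})" and "t \<ge> 0"
  shows "D = E"
proof (rule has_field_derivative_unique[OF assms(1,2)])
  have "t islimpt {t<..<t + 1}"
    by (rule islimpt_greaterThanLessThan1) simp
  then have "t islimpt {0..}"
    by (rule islimpt_subset) (use assms(3) in auto)
  then show "at t within {0..} \<noteq> bot"
    by (simp add: trivial_limit_within)
qed

text \<open>
  Integrating \<open>f\<^sub>x\<close> from \<open>p\<close> to \<open>x\<close> recovers \<open>f(x, t) - f(p, t)\<close>; differentiating this identity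
  in \<open>t\<close> under the integral sign exhibits \<open>f\<^sub>t(x, t)\<close> as a constant plus an integral of \<open>f\<^sub>x\<^sub>t\<close>,
  whose \<open>x\<close>-derivative is \<open>f\<^sub>x\<^sub>t\<close>. All derivatives may be one-sided, so the argument reaches the
  boundary of the strip, where the symmetry of second derivatives on open sets does not apply.
\<close>

lemma mixed_partials_commute:
  fixes f fx ft fxt :: "real \<Rightarrow> real \<Rightarrow> real"
  assumes dx: "\<And>x t. x \<in> {p..q} \<Longrightarrow> t \<ge> 0 \<Longrightarrow>
      ((\<lambda>\<xi>. f \<xi> t) has_real_derivative fx x t) (at x within {p..q})"
    and dt: "\<And>x t. x \<in> {p..q} \<Longrightarrow> t \<ge> 0 \<Longrightarrow>
      (f x has_real_derivative ft x t) (at t within {0..})"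
    and dxt: "\<And>x t. x \<in> {p..q} \<Longrightarrow> t \<ge> 0 \<Longrightarrow>
      (fx x has_real_derivative fxt x t) (at t within {0..})"
    and contx: "continuous_on ({p..q} \<times> {0..}) (\<lambda>(x, t). fx x t)"
    and contxt: "continuous_on ({p..q} \<times> {0..}) (\<lambda>(x, t). fxt x t)"
    and x: "x \<in> {p..q}" and t: "t \<ge> 0"
  shows "((\<lambda>\<xi>. ft \<xi> t) has_real_derivative fxt x t) (at x within {p..q})"
proof -
  have integral_fx: "((\<lambda>\<eta>. fx \<eta> s) has_integral f \<xi> s - f p s) {p..\<xi>}"
    if "\<xi> \<in> {p..q}" "s \<ge> 0" for \<xi> s
  proof (rule fundamental_theorem_of_calculus)
    show "p \<le> \<xi>" using that by simp
    show "((\<lambda>\<eta>. f \<eta> s) has_vector_derivative fx \<eta> s) (at \<eta> within {p..\<xi>})"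
      if "\<eta> \<in> {p..\<xi>}" for \<eta>
      using DERIV_subset[OF dx[of \<eta> s], of "{p..\<xi>}"] that \<open>\<xi> \<in> {p..q}\<close> \<open>s \<ge> 0\<close>
      by (auto simp: has_real_derivative_iff_has_vector_derivative)
  qed
  have ft_eq: "ft \<xi> t = ft p t + integral {p..\<xi>} (\<lambda>\<eta>. fxt \<eta> t)" if \<xi>: "\<xi> \<in> {p..q}" for \<xi>
  proof -
    have p: "p \<in> {p..q}" using \<xi> by simp
    have "((\<lambda>s. integral (cbox p \<xi>) (\<lambda>\<eta>. fx \<eta> s)) has_real_derivative
        integral (cbox p \<xi>) (\<lambda>\<eta>. fxt \<eta> t)) (at t within {0..})"
    proof (rule leibniz_rule_field_derivative[where f = "\<lambda>s \<eta>. fx \<eta> s" and fx = "\<lambda>s \<eta>. fxt \<eta> s"])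
      show "continuous_on ({0..} \<times> cbox p \<xi>) (\<lambda>(s, \<eta>). fxt \<eta> s)"
        by (rule continuous_on_subset[OF continuous_on_swap_args[OF contxt]]) (use \<xi> in auto)
      show "(\<lambda>\<eta>. fx \<eta> s) integrable_on cbox p \<xi>" if "s \<in> {0..}" for s
        using integral_fx[OF \<xi>] that by auto
    qed (use \<xi> t dxt in auto)
    moreover have "((\<lambda>s. f \<xi> s - f p s) has_real_derivative ft \<xi> t - ft p t) (at t within {0..})"
      by (intro DERIV_diff dt \<xi> p t)
    then have "((\<lambda>s. integral (cbox p \<xi>) (\<lambda>\<eta>. fx \<eta> s)) has_real_derivative
        ft \<xi> t - ft p t) (at t within {0..})"
      by (rule has_field_derivative_transform_within[where d = 1])
        (use t integral_unique[OF integral_fx[OF \<xi>]] in auto)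
    ultimately have "integral (cbox p \<xi>) (\<lambda>\<eta>. fxt \<eta> t) = ft \<xi> t - ft p t"
      using t by (rule has_real_derivative_unique_half_line)
    then show ?thesis by simp
  qed
  have "((\<lambda>\<xi>. integral {p..\<xi>} (\<lambda>\<eta>. fxt \<eta> t)) has_real_derivative fxt x t) (at x within {p..q})"
    by (rule integral_has_real_derivative) (use continuous_on_fixed_snd[OF contxt] t x in auto)
  then have "((\<lambda>\<xi>. ft p t + integral {p..\<xi>} (\<lambda>\<eta>. fxt \<eta> t)) has_real_derivative fxt x t)
      (at x within {p..q})"
    by (auto intro!: derivative_eq_intros)
  then show ?thesis
    by (rule has_field_derivative_transform_within[where d = 1]) (use ft_eq[symmetric] x in auto)
qed

section \<open>Energy balance for the wave equation on one piece\<close>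

text \<open>
  A solution of the wave equation on \<open>[p, q] \<times> [0, \<infinity>)\<close> together with its derivatives, which are
  one-sided on the boundary. Carrying the derivatives as parameters makes differences of solutions
  immediate and avoids choosing them anew in each argument. The field \<open>wxt\<close> is the derivative of
  both \<open>wx\<close> and \<open>wt\<close>: the symmetry of the mixed derivatives is part of the data.
\<close>

locale wave_jet =
  fixes a p q :: real and w wx wt wxx wxt wtt :: "real \<Rightarrow> real \<Rightarrow> real"
  assumes nondegenerate: "p < q"
    and deriv_x: "\<And>x t. x \<in> {p..q} \<Longrightarrow> t \<ge> 0 \<Longrightarrow>
      ((\<lambda>\<xi>. w \<xi> t) has_real_derivative wx x t) (at x within {p..q})"
    and deriv_t: "\<And>x t. x \<in> {p..q} \<Longrightarrow> t \<ge> 0 \<Longrightarrow>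
      (w x has_real_derivative wt x t) (at t within {0..})"
    and deriv_xx: "\<And>x t. x \<in> {p..q} \<Longrightarrow> t \<ge> 0 \<Longrightarrow>
      ((\<lambda>\<xi>. wx \<xi> t) has_real_derivative wxx x t) (at x within {p..q})"
    and deriv_xt: "\<And>x t. x \<in> {p..q} \<Longrightarrow> t \<ge> 0 \<Longrightarrow>
      (wx x has_real_derivative wxt x t) (at t within {0..})"
    and deriv_tx: "\<And>x t. x \<in> {p..q} \<Longrightarrow> t \<ge> 0 \<Longrightarrow>
      ((\<lambda>\<xi>. wt \<xi> t) has_real_derivative wxt x t) (at x within {p..q})"
    and deriv_tt: "\<And>x t. x \<in> {p..q} \<Longrightarrow> t \<ge> 0 \<Longrightarrow>
      (wt x has_real_derivative wtt x t) (at t within {0..})"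
    and cont_x: "continuous_on ({p..q} \<times> {0..}) (\<lambda>(x, t). wx x t)"
    and cont_t: "continuous_on ({p..q} \<times> {0..}) (\<lambda>(x, t). wt x t)"
    and cont_xt: "continuous_on ({p..q} \<times> {0..}) (\<lambda>(x, t). wxt x t)"
    and cont_tt: "continuous_on ({p..q} \<times> {0..}) (\<lambda>(x, t). wtt x t)"
    and wave_equation: "\<And>x t. p < x \<Longrightarrow> x < q \<Longrightarrow> t > 0 \<Longrightarrow> wtt x t = a\<^sup>2 * wxx x t"
begin

definition energy :: "real \<Rightarrow> real" where
  "energy t = integral {p..q} (\<lambda>x. (wt x t)\<^sup>2 + a\<^sup>2 * (wx x t)\<^sup>2)"

lemma continuous_density:
  assumes "t \<ge> 0"
  shows "continuous_on {p..q} (\<lambda>x. (wt x t)\<^sup>2 + a\<^sup>2 * (wx x t)\<^sup>2)"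
  by (intro continuous_intros continuous_on_fixed_snd[OF cont_t] continuous_on_fixed_snd[OF cont_x])
    (use assms in auto)

lemma energy_has_derivative_integral:
  assumes "t \<ge> 0"
  shows "(energy has_real_derivative
      integral {p..q} (\<lambda>x. 2 * (wt x t * wtt x t) + a\<^sup>2 * (2 * (wx x t * wxt x t))))
      (at t within {0..})"
proof -
  have "((\<lambda>s. integral (cbox p q) (\<lambda>x. (wt x s)\<^sup>2 + a\<^sup>2 * (wx x s)\<^sup>2)) has_real_derivative
      integral (cbox p q) (\<lambda>x. 2 * (wt x t * wtt x t) + a\<^sup>2 * (2 * (wx x t * wxt x t))))
      (at t within {0..})"
  proof (rule leibniz_rule_field_derivative[where
        f = "\<lambda>s x. (wt x s)\<^sup>2 + a\<^sup>2 * (wx x s)\<^sup>2" and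
        fx = "\<lambda>s x. 2 * (wt x s * wtt x s) + a\<^sup>2 * (2 * (wx x s * wxt x s))"])
    show "((\<lambda>s. (wt x s)\<^sup>2 + a\<^sup>2 * (wx x s)\<^sup>2) has_real_derivative
        2 * (wt x s * wtt x s) + a\<^sup>2 * (2 * (wx x s * wxt x s))) (at s within {0..})"
      if "s \<in> {0..}" "x \<in> cbox p q" for s x
      using that by (auto intro!: derivative_eq_intros deriv_tt deriv_xt)
    show "(\<lambda>x. (wt x s)\<^sup>2 + a\<^sup>2 * (wx x s)\<^sup>2) integrable_on cbox p q" if "s \<in> {0..}" for s
      using that continuous_density[of s] by (auto intro: integrable_continuous_real)
    show "continuous_on ({0..} \<times> cbox p q)
        (\<lambda>(s, x). 2 * (wt x s * wtt x s) + a\<^sup>2 * (2 * (wx x s * wxt x s)))"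
      using cont_tt[THEN continuous_on_swap_args]
        cont_x[THEN continuous_on_swap_args] cont_t[THEN continuous_on_swap_args]
        cont_xt[THEN continuous_on_swap_args]
      unfolding split_beta cbox_interval by (intro continuous_intros)
  qed (use assms in auto)
  then show ?thesis
    by (simp add: energy_def[abs_def])
qed

lemma continuous_energy: "continuous_on {0..} energy"
  using energy_has_derivative_integral
  by (auto simp: continuous_on_eq_continuous_within intro: DERIV_continuous)

text \<open>
  On solutions the time derivative \<open>2 (w\<^sub>t w\<^sub>t\<^sub>t + a\<^sup>2 w\<^sub>x w\<^sub>x\<^sub>t)\<close> of the energy density is the
  \<open>x\<close>-derivative of the flux \<open>2 a\<^sup>2 w\<^sub>x w\<^sub>t\<close>. This is known at interior points, where the wave
  equation holds; continuity of the flux up to the ends completes the integration over \<open>[p, q]\<close>.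
\<close>

lemma energy_balance:
  assumes t: "t > 0"
  shows "(energy has_real_derivative 2 * a\<^sup>2 * (wx q t * wt q t - wx p t * wt p t)) (at t)"
proof -
  have "((\<lambda>x. 2 * (wt x t * wtt x t) + a\<^sup>2 * (2 * (wx x t * wxt x t))) has_integral
      2 * a\<^sup>2 * (wx q t * wt q t) - 2 * a\<^sup>2 * (wx p t * wt p t)) {p..q}"
  proof (rule fundamental_theorem_of_calculus_interior)
    show "continuous_on {p..q} (\<lambda>x. 2 * a\<^sup>2 * (wx x t * wt x t))"
      by (intro continuous_intros continuous_on_fixed_snd[OF cont_t]
          continuous_on_fixed_snd[OF cont_x]) (use t in auto)
    show "((\<lambda>x. 2 * a\<^sup>2 * (wx x t * wt x t)) has_vector_derivative
        2 * (wt x t * wtt x t) + a\<^sup>2 * (2 * (wx x t * wxt x t))) (at x)"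
      if x: "x \<in> {p<..<q}" for x
    proof -
      have at: "at x within {p..q} = at x"
        using x by (intro at_within_interior) simp
      have "((\<lambda>\<xi>. wx \<xi> t) has_real_derivative wxx x t) (at x)"
        "((\<lambda>\<xi>. wt \<xi> t) has_real_derivative wxt x t) (at x)"
        using deriv_xx[of x t] deriv_tx[of x t] x t by (auto simp: at)
      then have "((\<lambda>x. 2 * a\<^sup>2 * (wx x t * wt x t)) has_real_derivative
          2 * (wt x t * wtt x t) + a\<^sup>2 * (2 * (wx x t * wxt x t))) (at x)"
        using wave_equation[of x t] x t
        by (auto intro!: derivative_eq_intros simp: algebra_simps)
      then show ?thesis
        by (simp add: has_real_derivative_iff_has_vector_derivative)
    qed
  qed (use nondegenerate in simp)
  moreover have "at t within {0..} = at t"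
    using t by (intro at_within_interior) simp
  ultimately show ?thesis
    using energy_has_derivative_integral[of t] t
    by (simp add: integral_unique right_diff_distrib)
qed

lemma energy_nonneg: "t \<ge> 0 \<Longrightarrow> energy t \<ge> 0"
  unfolding energy_def
  by (intro integral_nonneg integrable_continuous_real continuous_density) auto

lemma zero_energy_imp_zero_velocity:
  assumes "t \<ge> 0" and "energy t = 0" and "x \<in> {p..q}"
  shows "wt x t = 0"
proof -
  have "(wt x t)\<^sup>2 + a\<^sup>2 * (wx x t)\<^sup>2 = 0"
    using assms integral_eq_0_iff[OF continuous_density[OF assms(1)] nondegenerate]
    unfolding energy_def by simp
  then show ?thesis
    by (simp add: add_nonneg_eq_0_iff)
qed

lemma energy_zero_at_start:
  assumes w0: "\<And>x. x \<in> {p..q} \<Longrightarrow> w x 0 = 0" and wt0: "\<And>x. x \<in> {p..q} \<Longrightarrow> wt x 0 = 0"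
  shows "energy 0 = 0"
proof -
  have "wx x 0 = 0" if x: "x \<in> {p..q}" for x
  proof -
    have "((\<lambda>\<xi>. 0) has_real_derivative wx x 0) (at x within {p..q})"
      by (rule has_field_derivative_transform_within[OF deriv_x[OF x], where d = 1])
        (use x w0 in auto)
    moreover have "((\<lambda>\<xi>. 0) has_real_derivative 0) (at x within {p..q})"
      by simp
    moreover have "at x within {p..q} \<noteq> bot"
      using x nondegenerate by (simp add: trivial_limit_within islimpt_Icc)
    ultimately show ?thesis
      by (rule has_field_derivative_unique)
  qed
  then have "energy 0 = integral {p..q} (\<lambda>x. 0)"
    unfolding energy_def using wt0 by (intro integral_cong) simp
  then show ?thesis by simp
qed

lemma velocity_unique:
  assumes "x \<in> {p..q}" and "t \<ge> 0" and "(w x has_real_derivative D) (at t within {0..})"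
  shows "wt x t = D"
  using has_real_derivative_unique_half_line[OF deriv_t assms(3)] assms(1,2) by blast

lemma velocity_zero_if_fixed:
  assumes "x \<in> {p..q}" and "t \<ge> 0" and "\<And>s. s \<ge> 0 \<Longrightarrow> w x s = 0"
  shows "wt x t = 0"
proof (rule velocity_unique[OF assms(1,2)])
  have "((\<lambda>s. 0) has_real_derivative 0) (at t within {0..})"
    by simp
  then show "(w x has_real_derivative 0) (at t within {0..})"
    by (rule has_field_derivative_transform_within[where d = 1]) (use assms in auto)
qed

lemma zero_if_velocity_zero:
  assumes x: "x \<in> {p..q}" and t: "t \<ge> 0" and "w x 0 = 0" and "\<And>s. s \<ge> 0 \<Longrightarrow> wt x s = 0"
  shows "w x t = 0"
proof -
  have "(w x has_real_derivative 0) (at s within {0..})" if "s \<in> {0..}" for s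
    using deriv_t[OF x, of s] assms(4)[of s] that by simp
  then obtain c where "\<And>s. s \<in> {0..} \<Longrightarrow> w x s = c"
    using has_field_derivative_zero_constant[of "{0..}" "w x"] by auto
  with assms(2,3) show ?thesis
    by (metis atLeast_iff order_refl)
qed

lemma deriv_eq_slope:
  assumes "p < x" and "x < q" and "t \<ge> 0"
  shows "deriv (\<lambda>\<xi>. w \<xi> t) x = wx x t"
proof -
  have "at x within {p..q} = at x"
    using assms by (intro at_within_interior) simp
  then show ?thesis
    using deriv_x[of x t] assms by (intro DERIV_imp_deriv) simp
qed

text \<open>
  The next two lemmas turn interface conditions, stated as one-sided limits of the two-sided
  derivative, into conditions on \<open>wx\<close> at the end itself. The limits agree because \<open>wx\<close> is
  continuous up to the end and coincides with the two-sided derivative inside the piece.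
\<close>

lemma slope_at_right_end:
  assumes "t \<ge> 0" and "(deriv (\<lambda>\<xi>. w \<xi> t) \<longlongrightarrow> c) (at_left q)"
  shows "wx q t = c"
proof -
  have "((\<lambda>x. wx x t) \<longlongrightarrow> wx q t) (at q within {p..q})"
    using continuous_on_fixed_snd[OF cont_x, of t] assms(1) nondegenerate
    by (simp add: continuous_on_def)
  then have "((\<lambda>x. wx x t) \<longlongrightarrow> wx q t) (at_left q)"
    using nondegenerate by (simp add: at_within_Icc_at_left)
  moreover have "((\<lambda>x. wx x t) \<longlongrightarrow> c) (at_left q)"
  proof (rule Lim_transform_eventually[OF assms(2)])
    show "\<forall>\<^sub>F x in at_left q. deriv (\<lambda>\<xi>. w \<xi> t) x = wx x t"
      using eventually_at_left_field nondegenerate deriv_eq_slope[OF _ _ assms(1)] by blast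
  qed
  ultimately show ?thesis
    by (rule tendsto_unique[OF trivial_limit_at_left_real])
qed

lemma slope_at_left_end:
  assumes "t \<ge> 0" and "(deriv (\<lambda>\<xi>. w \<xi> t) \<longlongrightarrow> c) (at_right p)"
  shows "wx p t = c"
proof -
  have "((\<lambda>x. wx x t) \<longlongrightarrow> wx p t) (at p within {p..q})"
    using continuous_on_fixed_snd[OF cont_x, of t] assms(1) nondegenerate
    by (simp add: continuous_on_def)
  then have "((\<lambda>x. wx x t) \<longlongrightarrow> wx p t) (at_right p)"
    using nondegenerate by (simp add: at_within_Icc_at_right)
  moreover have "((\<lambda>x. wx x t) \<longlongrightarrow> c) (at_right p)"
  proof (rule Lim_transform_eventually[OF assms(2)])
    show "\<forall>\<^sub>F x in at_right p. deriv (\<lambda>\<xi>. w \<xi> t) x = wx x t"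
      using eventually_at_right_field nondegenerate deriv_eq_slope[OF _ _ assms(1)] by blast
  qed
  ultimately show ?thesis
    by (rule tendsto_unique[OF trivial_limit_at_right_real])
qed

end

lemma wave_jet_diff:
  assumes "wave_jet a p q u ux ut uxx uxt utt" and "wave_jet a p q v vx vt vxx vxt vtt"
  shows "wave_jet a p q (\<lambda>x t. u x t - v x t) (\<lambda>x t. ux x t - vx x t) (\<lambda>x t. ut x t - vt x t)
    (\<lambda>x t. uxx x t - vxx x t) (\<lambda>x t. uxt x t - vxt x t) (\<lambda>x t. utt x t - vtt x t)"
proof -
  interpret u: wave_jet a p q u ux ut uxx uxt utt by fact
  interpret v: wave_jet a p q v vx vt vxx vxt vtt by fact
  have cont: "continuous_on S (\<lambda>(x, t). f x t - g x t)"
    if "continuous_on S (\<lambda>(x, t). f x t)" "continuous_on S (\<lambda>(x, t). g x t)"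
    for S and f g :: "real \<Rightarrow> real \<Rightarrow> real"
    using continuous_on_diff[OF that] by (simp add: split_beta)
  show ?thesis
    by (intro wave_jet.intro DERIV_diff cont u.nondegenerate
        u.deriv_x u.deriv_t u.deriv_xx u.deriv_xt u.deriv_tx u.deriv_tt
        v.deriv_x v.deriv_t v.deriv_xx v.deriv_xt v.deriv_tx v.deriv_tt
        u.cont_x u.cont_t u.cont_xt u.cont_tt v.cont_x v.cont_t v.cont_xt v.cont_tt)
      (simp_all add: u.wave_equation v.wave_equation right_diff_distrib)
qed

section \<open>Conservation of the total energy\<close>

text \<open>
  The two pieces share the function \<open>w\<close>, so their velocities agree at \<open>l\<close>; the slopes there differ
  by the jump condition.
\<close>

lemma zero_initial_data_imp_zero:
  assumes "wave_jet a p l w wx1 wt1 wxx1 wxt1 wtt1"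
    and "wave_jet a l q w wx2 wt2 wxx2 wxt2 wtt2"
    and "\<sigma> \<ge> 0"
    and fixed_ends: "\<And>t. t \<ge> 0 \<Longrightarrow> w p t = 0" "\<And>t. t \<ge> 0 \<Longrightarrow> w q t = 0"
    and jump: "\<And>t. t \<ge> 0 \<Longrightarrow> - wx1 l t + wx2 l t = \<sigma> * w l t"
    and w0: "\<And>x. x \<in> {p..q} \<Longrightarrow> w x 0 = 0"
    and wt0: "\<And>x. x \<in> {p..q} \<Longrightarrow> (w x has_real_derivative 0) (at 0 within {0..})"
    and x: "x \<in> {p..q}" and t: "t \<ge> 0"
  shows "w x t = 0"
proof -
  interpret left: wave_jet a p l w wx1 wt1 wxx1 wxt1 wtt1 by fact
  interpret right: wave_jet a l q w wx2 wt2 wxx2 wxt2 wtt2 by fact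
  have pl: "p < l" and lq: "l < q"
    by (rule left.nondegenerate right.nondegenerate)+
  define F where "F s = left.energy s + right.energy s + a\<^sup>2 * \<sigma> * (w l s)\<^sup>2" for s
  have same_velocity: "wt1 l s = wt2 l s" if "s \<ge> 0" for s
    using that pl lq by (intro left.velocity_unique right.deriv_t) auto
  have F0: "F 0 = 0"
    using left.energy_zero_at_start right.energy_zero_at_start
      left.velocity_unique[OF _ _ wt0] right.velocity_unique[OF _ _ wt0] w0 pl lq
    by (simp add: F_def)
  have DF: "(F has_real_derivative 0) (at s)" if s: "s > 0" for s
  proof -
    have at: "at s within {0..} = at s"
      using s by (intro at_within_interior) simp
    have "(w l has_real_derivative wt2 l s) (at s)"
      using right.deriv_t[of l s] s lq by (simp add: at)
    then have "(F has_real_derivative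
        2 * a\<^sup>2 * (wx1 l s * wt1 l s - wx1 p s * wt1 p s)
        + 2 * a\<^sup>2 * (wx2 q s * wt2 q s - wx2 l s * wt2 l s)
        + a\<^sup>2 * \<sigma> * (2 * (w l s * wt2 l s))) (at s)"
      unfolding F_def[abs_def]
      by (auto intro!: derivative_eq_intros left.energy_balance[OF s] right.energy_balance[OF s])
    moreover have "wt1 p s = 0" "wt2 q s = 0"
      using left.velocity_zero_if_fixed[of p s] right.velocity_zero_if_fixed[of q s]
        fixed_ends pl lq s by auto
    moreover have "wx2 l s = wx1 l s + \<sigma> * w l s"
      using jump[of s] s by simp
    ultimately show ?thesis
      using same_velocity[of s] s by (simp add: algebra_simps)
  qed
  have continuous_F: "continuous_on {0..} F"
  proof -
    have "continuous_on {0..} (w l)"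
      using right.deriv_t[of l] lq
      by (auto simp: continuous_on_eq_continuous_within intro!: DERIV_continuous)
    then show ?thesis
      unfolding F_def[abs_def]
      by (intro continuous_intros left.continuous_energy right.continuous_energy)
  qed
  have F_zero: "F s = 0" if "s \<ge> 0" for s
  proof (cases "s = 0")
    case False
    then have "F s = F 0"
      using that DF continuous_on_subset[OF continuous_F]
      by (intro DERIV_isconst_end) auto
    then show ?thesis using F0 by simp
  qed (use F0 in simp)
  have energies_zero: "left.energy s = 0 \<and> right.energy s = 0" if "s \<ge> 0" for s
  proof -
    have "a\<^sup>2 * \<sigma> * (w l s)\<^sup>2 \<ge> 0"
      using \<open>\<sigma> \<ge> 0\<close> by simp
    then show ?thesis
      using F_zero[OF that] left.energy_nonneg[OF that] right.energy_nonneg[OF that]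
      unfolding F_def by linarith
  qed
  show ?thesis
  proof (cases "x \<le> l")
    case True
    then have "x \<in> {p..l}"
      using x by simp
    then show ?thesis
      using t w0[OF x] energies_zero left.zero_energy_imp_zero_velocity
      by (blast intro: left.zero_if_velocity_zero)
  next
    case False
    then have "x \<in> {l..q}"
      using x by simp
    then show ?thesis
      using t w0[OF x] energies_zero right.zero_energy_imp_zero_velocity
      by (blast intro: right.zero_if_velocity_zero)
  qed
qed

section \<open>From classical solutions to jets\<close>

lemma Ck_on_imp_continuous:
  "Ck_on k I J u \<Longrightarrow> continuous_on (I \<times> J) (\<lambda>(x, t). u x t)"
  by (cases k) auto

lemma Ck_on_SucE:
  assumes "Ck_on (Suc k) I J u"
  obtains ux ut where
    "\<forall>x\<in>I. \<forall>t\<in>J. ((\<lambda>\<xi>. u \<xi> t) has_real_derivative ux x t) (at x within I)" and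
    "\<forall>x\<in>I. \<forall>t\<in>J. (u x has_real_derivative ut x t) (at t within J)" and
    "Ck_on k I J ux" and "Ck_on k I J ut"
  using assms unfolding Ck_on.simps by blast

text \<open>
  The mixed derivative entering the jet is the \<open>t\<close>-derivative of \<open>ux\<close>; by
  \<open>mixed_partials_commute\<close> it is the \<open>x\<close>-derivative of \<open>ut\<close> as well.
\<close>

lemma Ck_on_2_imp_wave_jet:
  assumes C2: "Ck_on 2 {p..q} {0..} u" and pq: "p < q"
    and pde: "\<And>x t. p < x \<Longrightarrow> x < q \<Longrightarrow> t > 0 \<Longrightarrow>
      (deriv ^^ 2) (\<lambda>\<tau>. u x \<tau>) t - a\<^sup>2 * (deriv ^^ 2) (\<lambda>\<xi>. u \<xi> t) x = 0"
  shows "\<exists>ux ut uxx uxt utt. wave_jet a p q u ux ut uxx uxt utt"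
proof -
  have "Ck_on (Suc (Suc 0)) {p..q} {0..} u"
    using C2 by (simp only: numeral_2_eq_2)
  then obtain ux ut where
    dx': "\<forall>x\<in>{p..q}. \<forall>t\<in>{0..}. ((\<lambda>\<xi>. u \<xi> t) has_real_derivative ux x t) (at x within {p..q})" and
    dt': "\<forall>x\<in>{p..q}. \<forall>t\<in>{0..}. (u x has_real_derivative ut x t) (at t within {0..})" and
    ux: "Ck_on (Suc 0) {p..q} {0..} ux" and ut: "Ck_on (Suc 0) {p..q} {0..} ut"
    by (rule Ck_on_SucE)
  obtain uxx uxt where
    dxx': "\<forall>x\<in>{p..q}. \<forall>t\<in>{0..}. ((\<lambda>\<xi>. ux \<xi> t) has_real_derivative uxx x t) (at x within {p..q})" and
    dxt': "\<forall>x\<in>{p..q}. \<forall>t\<in>{0..}. (ux x has_real_derivative uxt x t) (at t within {0..})" and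
    uxx: "Ck_on 0 {p..q} {0..} uxx" and uxt: "Ck_on 0 {p..q} {0..} uxt"
    using ux by (rule Ck_on_SucE)
  obtain utx utt where
    "\<forall>x\<in>{p..q}. \<forall>t\<in>{0..}. ((\<lambda>\<xi>. ut \<xi> t) has_real_derivative utx x t) (at x within {p..q})" and
    dtt': "\<forall>x\<in>{p..q}. \<forall>t\<in>{0..}. (ut x has_real_derivative utt x t) (at t within {0..})" and
    "Ck_on 0 {p..q} {0..} utx" and utt: "Ck_on 0 {p..q} {0..} utt"
    using ut by (rule Ck_on_SucE)
  note dx = dx'[rule_format, unfolded atLeast_iff]
    and dt = dt'[rule_format, unfolded atLeast_iff]
    and dxx = dxx'[rule_format, unfolded atLeast_iff]
    and dxt = dxt'[rule_format, unfolded atLeast_iff]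
    and dtt = dtt'[rule_format, unfolded atLeast_iff]
  note cx = Ck_on_imp_continuous[OF ux] and ct = Ck_on_imp_continuous[OF ut]
    and cxt = Ck_on_imp_continuous[OF uxt] and ctt = Ck_on_imp_continuous[OF utt]
  have "utt x t = a\<^sup>2 * uxx x t" if x: "p < x" "x < q" and t: "t > 0" for x t
  proof -
    have at_x: "at \<xi> within {p..q} = at \<xi>" if "\<xi> \<in> {p<..<q}" for \<xi>
      using that by (intro at_within_interior) simp
    have at_t: "at \<tau> within {0..} = at \<tau>" if "\<tau> > 0" for \<tau> :: real
      using that by (intro at_within_interior) simp
    have "deriv (deriv (\<lambda>\<xi>. u \<xi> t)) x = uxx x t"
    proof (rule DERIV_imp_deriv)
      have D: "((\<lambda>\<xi>. ux \<xi> t) has_real_derivative uxx x t) (at x)"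
        using dxx[of x t] x t by (simp add: at_x)
      have "deriv (\<lambda>\<xi>. u \<xi> t) \<xi> = ux \<xi> t" if "\<xi> \<in> {p<..<q}" for \<xi>
        using dx[of \<xi> t] that t by (intro DERIV_imp_deriv) (simp add: at_x)
      then show "(deriv (\<lambda>\<xi>. u \<xi> t) has_real_derivative uxx x t) (at x)"
        using x
        by (intro has_field_derivative_transform_within_open[OF D, where S = "{p<..<q}"]) auto
    qed
    moreover have "deriv (deriv (u x)) t = utt x t"
    proof (rule DERIV_imp_deriv)
      have D: "(ut x has_real_derivative utt x t) (at t)"
        using dtt[of x t] x t by (simp add: at_t)
      have "deriv (u x) \<tau> = ut x \<tau>" if "\<tau> \<in> {0<..}" for \<tau>
        using dt[of x \<tau>] that x by (intro DERIV_imp_deriv) (simp add: at_t)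
      then show "(deriv (u x) has_real_derivative utt x t) (at t)"
        using t
        by (intro has_field_derivative_transform_within_open[OF D, where S = "{0<..}"]) auto
    qed
    ultimately show ?thesis
      using pde[OF x t] by (simp add: numeral_2_eq_2)
  qed
  moreover have "((\<lambda>\<xi>. ut \<xi> t) has_real_derivative uxt x t) (at x within {p..q})"
    if "x \<in> {p..q}" "t \<ge> 0" for x t
    using dx dt dxt cx cxt that by (rule mixed_partials_commute)
  ultimately have "wave_jet a p q u ux ut uxx uxt utt"
    by (intro wave_jet.intro pq dx dt dxx dxt dtt cx ct cxt ctt)
  then show ?thesis by blast
qed

lemma classical_solution_imp_wave_jets:
  assumes "0 < l" and "l < L" and u: "classical_solution l L a \<sigma> \<phi> \<psi> u"
  obtains ux1 ut1 uxx1 uxt1 utt1 ux2 ut2 uxx2 uxt2 utt2 where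
    "wave_jet a 0 l u ux1 ut1 uxx1 uxt1 utt1" and
    "wave_jet a l L u ux2 ut2 uxx2 uxt2 utt2" and
    "\<forall>t\<ge>0. - ux1 l t + ux2 l t = \<sigma> * u l t"
proof -
  have C2: "Ck_on 2 {0..l} {0..} u" "Ck_on 2 {l..L} {0..} u"
    using u by (auto simp: classical_solution_def classical_regularity_def)
  have pde: "(deriv ^^ 2) (\<lambda>\<tau>. u x \<tau>) t - a\<^sup>2 * (deriv ^^ 2) (\<lambda>\<xi>. u \<xi> t) x = 0"
    if "x \<in> {0<..<l} \<union> {l<..<L}" "t > 0" for x t
    using u that unfolding classical_solution_def by blast
  have "\<exists>ux ut uxx uxt utt. wave_jet a 0 l u ux ut uxx uxt utt"
    by (rule Ck_on_2_imp_wave_jet[OF C2(1) assms(1) pde]) auto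
  then obtain ux1 ut1 uxx1 uxt1 utt1 where left: "wave_jet a 0 l u ux1 ut1 uxx1 uxt1 utt1"
    by blast
  have "\<exists>ux ut uxx uxt utt. wave_jet a l L u ux ut uxx uxt utt"
    by (rule Ck_on_2_imp_wave_jet[OF C2(2) assms(2) pde]) auto
  then obtain ux2 ut2 uxx2 uxt2 utt2 where right: "wave_jet a l L u ux2 ut2 uxx2 uxt2 utt2"
    by blast
  have "- ux1 l t + ux2 l t = \<sigma> * u l t" if t: "t \<ge> 0" for t
  proof -
    obtain pl pr where
      "(deriv (\<lambda>\<xi>. u \<xi> t) \<longlongrightarrow> pl) (at_left l)"
      "(deriv (\<lambda>\<xi>. u \<xi> t) \<longlongrightarrow> pr) (at_right l)"
      "- pl + pr = \<sigma> * u l t"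
      using u t unfolding classical_solution_def by blast
    then show ?thesis
      using wave_jet.slope_at_right_end[OF left t] wave_jet.slope_at_left_end[OF right t] by simp
  qed
  then show thesis
    using that[OF left right] by blast
qed

section \<open>Uniqueness\<close>

theorem theorem2p1:
  fixes l L a \<sigma> :: real
    and \<phi> \<psi> :: "real \<Rightarrow> real"
    and u v :: "real \<Rightarrow> real \<Rightarrow> real"
  assumes "0 < l" and "l < L" and "a > 0" and "\<sigma> > 0"
    and "classical_solution l L a \<sigma> \<phi> \<psi> u"
    and "classical_solution l L a \<sigma> \<phi> \<psi> v"
  shows "\<forall>x\<in>{0..L}. \<forall>t\<ge>0. u x t = v x t"
proof (intro ballI allI impI)
  fix x t :: real
  assume x: "x \<in> {0..L}" and t: "t \<ge> 0"
  obtain ux1 ut1 uxx1 uxt1 utt1 ux2 ut2 uxx2 uxt2 utt2 where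
    u: "wave_jet a 0 l u ux1 ut1 uxx1 uxt1 utt1" "wave_jet a l L u ux2 ut2 uxx2 uxt2 utt2"
    and u_jump: "\<forall>t\<ge>0. - ux1 l t + ux2 l t = \<sigma> * u l t"
    by (rule classical_solution_imp_wave_jets[OF assms(1,2,5)])
  obtain vx1 vt1 vxx1 vxt1 vtt1 vx2 vt2 vxx2 vxt2 vtt2 where
    v: "wave_jet a 0 l v vx1 vt1 vxx1 vxt1 vtt1" "wave_jet a l L v vx2 vt2 vxx2 vxt2 vtt2"
    and v_jump: "\<forall>t\<ge>0. - vx1 l t + vx2 l t = \<sigma> * v l t"
    by (rule classical_solution_imp_wave_jets[OF assms(1,2,6)])
  have "u x t - v x t = 0"
  proof (rule zero_initial_data_imp_zero[where w = "\<lambda>x t. u x t - v x t",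
        OF wave_jet_diff[OF u(1) v(1)] wave_jet_diff[OF u(2) v(2)] _ _ _ _ _ _ x t])
    show "- (ux1 l s - vx1 l s) + (ux2 l s - vx2 l s) = \<sigma> * (u l s - v l s)" if "s \<ge> 0" for s
      using u_jump v_jump that by (simp add: algebra_simps)
    show "((\<lambda>s. u y s - v y s) has_real_derivative 0) (at 0 within {0..})" if "y \<in> {0..L}" for y
      using DERIV_diff[of "u y" "\<psi> y" 0 "{0..}" "v y" "\<psi> y"] assms(5,6) that
      unfolding classical_solution_def by auto
  qed (use assms(4-6) in \<open>auto simp: classical_solution_def\<close>)
  then show "u x t = v x t" by simp
qed

end
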